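(* Let $m,n$ be positive real numbers, $T=[0,m]\times[0,n]$, $A\subseteq T$ Lebesgue measurable with characteristic function $f_A$ on $T$, and $\lambda(A)$ its Lebesgue measure. For a bounded Lebesgue-measurable $f:T\to\mathbb{R}$ let $c_f(x)=\int_0^n f(x,y)\,dy$ ($x\in[0,m]$) and $r_f(y)=\int_0^m f(x,y)\,dx$ ($y\in[0,n]$). Let $L$ be the set of bounded Lebesgue-integrable functions $f:T\to\mathbb{R}$ with $c_f(x)=c_{f_A}(x)$ for all $x\in[0,m]$ and $r_f(y)=r_{f_A}(y)$ for all $y\in[0,n]$. Then $L$ has an element of smallest norm $\|f\|=\left(\iint_T f(x,y)^2\,dx\,dy\right)^{1/2}$, and it is given by $$f_0(x,y)=\frac{c_{f_A}(x)}{n}+\frac{r_{f_A}(y)}{m}-\frac{\lambda(A)}{mn}\qquad((x,y)\in T).$$ *)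

theory Defs
  imports "HOL-Analysis.Analysis"
begin

definition rect :: "real \<Rightarrow> real \<Rightarrow> (real \<times> real) set" where
  "rect m n = {0..m} \<times> {0..n}"

text \<open>
  A function on the rectangle is represented by a function on the whole plane; everything below
  depends only on its values on the rectangle.

  A Lebesgue measurable function on the plane may have non-measurable sections over a null set of
  abscissae or ordinates. There the library convention applies that the Lebesgue integral of a
  non-integrable function is \<open>0\<close>, so that both projections are defined everywhere.
\<close>

definition col_int :: "real \<Rightarrow> (real \<times> real \<Rightarrow> real) \<Rightarrow> real \<Rightarrow> real" where
  "col_int n f x = (LINT y:{0..n}|lebesgue. f (x, y))"

definition row_int :: "real \<Rightarrow> (real \<times> real \<Rightarrow> real) \<Rightarrow> real \<Rightarrow> real" where
  "row_int m f y = (LINT x:{0..m}|lebesgue. f (x, y))"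

definition same_proj ::
    "real \<Rightarrow> real \<Rightarrow> (real \<times> real) set \<Rightarrow> (real \<times> real \<Rightarrow> real) set" where
  "same_proj m n A =
    {f. bounded (f ` rect m n) \<and> set_integrable lebesgue (rect m n) f \<and>
        (\<forall>x\<in>{0..m}. col_int n f x = col_int n (indicator A) x) \<and>
        (\<forall>y\<in>{0..n}. row_int m f y = row_int m (indicator A) y)}"

definition rect_norm :: "real \<Rightarrow> real \<Rightarrow> (real \<times> real \<Rightarrow> real) \<Rightarrow> real" where
  "rect_norm m n f = sqrt (LINT z:rect m n|lebesgue. (f z)\<^sup>2)"

definition min_sol ::
    "real \<Rightarrow> real \<Rightarrow> (real \<times> real) set \<Rightarrow> real \<times> real \<Rightarrow> real" where
  "min_sol m n A = (\<lambda>(x, y).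
     col_int n (indicator A) x / n + row_int m (indicator A) y / m - measure lebesgue A / (m * n))"

end

theory Submission
  imports Defs
begin

text \<open>
  Since \<open>f\<^sub>0\<close> is a function of \<open>x\<close> plus a function of \<open>y\<close>, Fubini's theorem expresses
  \<open>\<integral>\<integral> f\<^sub>0 f\<close> through the two projections of \<open>f\<close> alone. So this integral has the same value for all
  \<open>f\<close> in \<open>L\<close>, among them \<open>f\<^sub>0\<close> itself, and hence \<open>\<parallel>f - f\<^sub>0\<parallel>\<^sup>2 = \<parallel>f\<parallel>\<^sup>2 - \<parallel>f\<^sub>0\<parallel>\<^sup>2\<close> on \<open>L\<close>. This gives
  minimality, and uniqueness up to null sets.

  As \<open>lebesgue\<close> on the plane is the completion of a product measure rather than a product, Fubini's
  theorem has to be transferred from \<open>lborel\<close> through an almost everywhere equal Borel function.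
\<close>

section \<open>Coordinate projection and coordinate swap for Lebesgue measure on a product\<close>

text \<open>Continuity only makes preimages of Borel sets measurable. For the completion on the
  target side, preimages of null sets must be null as well, and the preimage of a null set
  \<open>N\<close> is the null cylinder \<open>N \<times> UNIV\<close>. This makes
  \<open>u (fst z)\<close> measurable for every Lebesgue measurable weight \<open>u\<close>.\<close>

lemma measurable_fst_lebesgue:
  "fst \<in> (lebesgue :: ('a::euclidean_space \<times> 'b::euclidean_space) measure) \<rightarrow>\<^sub>M lebesgue"
proof (rule completion.measurable_completion2)
  show meas: "fst \<in> (lebesgue :: ('a \<times> 'b) measure) \<rightarrow>\<^sub>M lborel"
    using borel_measurable_continuous_onI[OF continuous_on_fst[OF continuous_on_id]]
    by (intro measurable_completion) auto
  show "null_sets lborel \<subseteq> null_sets (distr (lebesgue :: ('a \<times> 'b) measure) lborel fst)"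
  proof
    fix N :: "'a set" assume N: "N \<in> null_sets lborel"
    have "N \<times> (UNIV :: 'b set) \<in> null_sets (lborel \<Otimes>\<^sub>M lborel)"
      using N by (intro lborel.times_in_null_sets1) auto
    then have "N \<times> (UNIV :: 'b set) \<in> null_sets lebesgue"
      unfolding lborel_prod by (rule null_sets_completionI)
    moreover have "fst -` N = N \<times> (UNIV :: 'b set)" by auto
    ultimately show "N \<in> null_sets (distr (lebesgue :: ('a \<times> 'b) measure) lborel fst)"
      using N by (simp add: null_sets_distr_iff[OF meas] null_setsD2[OF N, simplified])
  qed
qed

lemma distr_swap_lborel:
  "distr (lborel :: ('a::euclidean_space \<times> 'b::euclidean_space) measure) lborel prod.swap = lborel"
  using lborel_pair.distr_pair_swap[where ?'a = 'b and ?'b = 'a]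
  by (simp add: lborel_prod prod.swap_def[abs_def] case_prod_unfold)

text \<open>The swap is a Borel map that preserves \<open>lborel\<close>, hence also its null sets,
  so both properties pass to the completions. All statements about rows are later derived from those
  about columns through this symmetry.\<close>

lemma measurable_swap_lebesgue:
  "prod.swap \<in> (lebesgue :: ('a::euclidean_space \<times> 'b::euclidean_space) measure) \<rightarrow>\<^sub>M lebesgue"
  and distr_swap_lebesgue:
  "distr (lebesgue :: ('a \<times> 'b) measure) lebesgue prod.swap = lebesgue"
proof -
  have meas: "prod.swap \<in> (lborel :: ('a \<times> 'b) measure) \<rightarrow>\<^sub>M lborel"
    by (auto intro!: borel_measurable_continuous_onI continuous_on_swap)
  have "distr (lebesgue :: ('a \<times> 'b) measure) lborel prod.swap = lborel"
    by (simp add: distr_completion[OF meas] distr_swap_lborel)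
  note * = measurable_completion[OF meas] this
  show "prod.swap \<in> (lebesgue :: ('a \<times> 'b) measure) \<rightarrow>\<^sub>M lebesgue"
    by (rule completion.measurable_completion2) (use * in auto)
  have "completion (distr (lebesgue :: ('a \<times> 'b) measure) lborel prod.swap) =
      distr lebesgue lebesgue prod.swap"
    by (rule completion.completion_distr_eq) (use * in auto)
  then show "distr (lebesgue :: ('a \<times> 'b) measure) lebesgue prod.swap = lebesgue"
    using *(2) by simp
qed

section \<open>Fubini's theorem for Lebesgue measure on a product\<close>

lemma integrable_lebesgue_borel_version:
  fixes f :: "'a::euclidean_space \<Rightarrow> real"
  assumes "integrable lebesgue f"
  obtains g where "integrable lborel g" "AE x in lborel. f x = g x"
    "integral\<^sup>L lborel g = integral\<^sup>L lebesgue f"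
proof -
  obtain g where g: "g \<in> borel_measurable lborel" "AE x in lborel. f x = g x"
    using completion_ex_borel_measurable_real[of f lborel] assms by auto
  have ae: "AE x in lebesgue. f x = g x" using g(2) by (rule AE_completion)
  have g': "g \<in> borel_measurable lebesgue" using g(1) by (rule measurable_completion)
  have "integrable lebesgue g"
    using integrable_cong_AE[OF borel_measurable_integrable[OF assms] g' ae] assms by simp
  then have "integrable lborel g" using integrable_completion[OF g(1)] by simp
  moreover have "integral\<^sup>L lborel g = integral\<^sup>L lebesgue f"
    using integral_cong_AE[OF borel_measurable_integrable[OF assms] g' ae] integral_completion[OF g(1)]
    by simp
  ultimately show thesis using that g(2) by blast
qed

text \<open>Fubini's theorem for a Borel version \<open>g\<close> of \<open>f\<close> is carried
  back to \<open>f\<close>: for almost every \<open>x\<close> the sections of \<open>f\<close> and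
  \<open>g\<close> agree almost everywhere, so the inner integrals agree for almost every
  \<open>x\<close>. On the exceptional null set of \<open>x\<close> the inner integral of
  \<open>f\<close> may have any value.\<close>

lemma
  fixes f :: "'a::euclidean_space \<times> 'b::euclidean_space \<Rightarrow> real"
  assumes f: "integrable lebesgue f"
  shows lebesgue_integrable_fst: "integrable lebesgue (\<lambda>x. LINT y|lebesgue. f (x, y))"
    and lebesgue_integral_fst: "(LINT x|lebesgue. LINT y|lebesgue. f (x, y)) = integral\<^sup>L lebesgue f"
proof -
  obtain g where g: "integrable lborel g" "AE z in lborel. f z = g z"
    and int: "integral\<^sup>L lborel g = integral\<^sup>L lebesgue f"
    using integrable_lebesgue_borel_version[OF f] .
  have g': "integrable (lborel \<Otimes>\<^sub>M lborel) g" using g(1) by (simp add: lborel_prod)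
  have "AE x in lborel. AE y in lborel. f (x, y) = g (x, y)"
    using g(2) by (intro lborel_pair.AE_pair) (unfold lborel_prod)
  then have "AE x in lborel. (LINT y|lebesgue. f (x, y)) = (LINT y|lborel. g (x, y))"
    using lborel_pair.AE_integrable_fst'[OF g']
  proof eventually_elim
    case (elim x)
    have m: "(\<lambda>y. g (x, y)) \<in> borel_measurable lborel" using elim(2) by simp
    have ae: "AE y in lebesgue. g (x, y) = f (x, y)"
      using AE_completion[OF elim(1)] by (simp add: eq_commute)
    have gm: "(\<lambda>y. g (x, y)) \<in> borel_measurable lebesgue"
      using m by (rule measurable_completion)
    \<comment> \<open>Completeness of Lebesgue measure enters here: a function that equals a
      measurable one almost everywhere is itself measurable. The same argument serves below for the
      function of inner integrals.\<close>
    have fm: "(\<lambda>y. f (x, y)) \<in> borel_measurable lebesgue"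
      using borel_measurable_AE[OF gm ae] .
    show ?case
      using integral_cong_AE[OF gm fm ae] integral_completion[OF m] by simp
  qed
  then have sec: "AE x in lebesgue. (LINT y|lebesgue. f (x, y)) = (LINT y|lborel. g (x, y))"
    by (rule AE_completion)
  have gi: "integrable lborel (\<lambda>x. LINT y|lborel. g (x, y))"
    using lborel_pair.integrable_fst'[OF g'] .
  have gi': "integrable lebesgue (\<lambda>x. LINT y|lborel. g (x, y))"
    using gi integrable_completion[OF borel_measurable_integrable[OF gi]] by simp
  have ae: "AE x in lebesgue. (LINT y|lborel. g (x, y)) = (LINT y|lebesgue. f (x, y))"
    using sec by auto
  have fm: "(\<lambda>x. LINT y|lebesgue. f (x, y)) \<in> borel_measurable lebesgue"
    using borel_measurable_AE[OF borel_measurable_integrable[OF gi'] ae] .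
  show "integrable lebesgue (\<lambda>x. LINT y|lebesgue. f (x, y))"
    using integrable_cong_AE[OF borel_measurable_integrable[OF gi'] fm ae] gi' by simp
  show "(LINT x|lebesgue. LINT y|lebesgue. f (x, y)) = integral\<^sup>L lebesgue f"
    using integral_cong_AE[OF borel_measurable_integrable[OF gi'] fm ae]
      integral_completion[OF borel_measurable_integrable[OF gi]]
      lborel_pair.integral_fst'[OF g'] int by (simp add: lborel_prod)
qed

lemma
  fixes f :: "'a::euclidean_space \<times> 'b::euclidean_space \<Rightarrow> real"
  assumes f: "integrable lebesgue f"
  shows lebesgue_integrable_swap: "integrable lebesgue (\<lambda>z. f (prod.swap z))"
    and lebesgue_integral_swap: "(LINT z|lebesgue. f (prod.swap z)) = integral\<^sup>L lebesgue f"
proof -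
  show "integrable lebesgue (\<lambda>z. f (prod.swap z))"
    using integrable_distr[OF measurable_swap_lebesgue, of f] f by (simp add: distr_swap_lebesgue)
  show "(LINT z|lebesgue. f (prod.swap z)) = integral\<^sup>L lebesgue f"
    using integral_distr[OF measurable_swap_lebesgue borel_measurable_integrable[OF f]]
    by (simp add: distr_swap_lebesgue)
qed

section \<open>Integrals over the rectangle with weights depending on one coordinate\<close>

lemma set_integrable_mult_bounded:
  fixes f h :: "'a \<Rightarrow> real"
  assumes f: "set_integrable M S f" and h: "set_borel_measurable M S h"
    and K: "\<And>x. x \<in> S \<Longrightarrow> \<bar>h x\<bar> \<le> K"
  shows "set_integrable M S (\<lambda>x. h x * f x)"
proof (rule set_integrable_bound)
  show "set_integrable M S (\<lambda>x. K * f x)" using f by simp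
  \<comment> \<open>Measurability is known only for the two functions cut off outside
    \<open>S\<close>; as the indicator is idempotent, the product of the cut-offs is the cut-off of
    the product.\<close>
  have "(\<lambda>x. (indicator S x *\<^sub>R h x) * (indicator S x *\<^sub>R f x)) \<in> borel_measurable M"
    using f h unfolding set_integrable_def set_borel_measurable_def by auto
  then show "set_borel_measurable M S (\<lambda>x. h x * f x)"
    unfolding set_borel_measurable_def
    by (rule measurable_cong[THEN iffD1, rotated]) (auto simp: indicator_def)
  show "AE x in M. x \<in> S \<longrightarrow> norm (h x * f x) \<le> norm (K * f x)"
  proof (rule AE_I2, rule impI)
    fix x assume "x \<in> S"
    then have "\<bar>h x\<bar> \<le> \<bar>K\<bar>" using K[of x] by linarith
    then show "norm (h x * f x) \<le> norm (K * f x)" by (simp add: abs_mult mult_right_mono)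
  qed
qed

lemma integrable_indicator_lmeasurable:
  "S \<in> lmeasurable \<Longrightarrow> integrable lebesgue (indicator S :: _ \<Rightarrow> real)"
  by (auto simp: fmeasurable_def)

lemma rect_lmeasurable: "rect m n \<in> lmeasurable"
  unfolding rect_def by (intro lmeasurable_compact compact_Times) auto

lemma swap_mem_rect: "prod.swap z \<in> rect m n \<longleftrightarrow> z \<in> rect n m"
  by (cases z) (auto simp: rect_def)

lemma set_integrable_rect_swap:
  fixes f :: "real \<times> real \<Rightarrow> real"
  shows "set_integrable lebesgue (rect m n) f \<Longrightarrow> set_integrable lebesgue (rect n m) (\<lambda>z. f (prod.swap z))"
  unfolding set_integrable_def
  using lebesgue_integrable_swap[of "\<lambda>z. indicator (rect m n) z *\<^sub>R f z"]
  by (simp add: indicator_def swap_mem_rect)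

lemma set_integral_rect_swap:
  fixes f :: "real \<times> real \<Rightarrow> real"
  shows "set_integrable lebesgue (rect m n) f \<Longrightarrow>
    (LINT z:rect n m|lebesgue. f (prod.swap z)) = (LINT z:rect m n|lebesgue. f z)"
  unfolding set_integrable_def set_lebesgue_integral_def
  using lebesgue_integral_swap[of "\<lambda>z. indicator (rect m n) z *\<^sub>R f z"]
  by (simp add: indicator_def swap_mem_rect)

lemma col_int_swap: "col_int m (\<lambda>z. f (prod.swap z)) = row_int m f"
  by (simp add: col_int_def row_int_def fun_eq_iff)

lemma set_integral_col_int:
  assumes f: "set_integrable lebesgue (rect m n) f"
  shows "(LINT x:{0..m}|lebesgue. col_int n f x) = (LINT z:rect m n|lebesgue. f z)"
proof -
  \<comment> \<open>Extending \<open>f\<close> by zero outside the rectangle turns the claim into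
    Fubini on the whole plane; sections at \<open>x\<close> outside \<open>{0..m}\<close> vanish
    identically.\<close>
  have eq: "(LINT y|lebesgue. indicator (rect m n) (x, y) *\<^sub>R f (x, y)) =
      indicator {0..m} x *\<^sub>R col_int n f x" for x
    by (cases "x \<in> {0..m}") (auto simp: col_int_def rect_def set_lebesgue_integral_def indicator_def
        intro!: Bochner_Integration.integral_cong)
  note f' = f[unfolded set_integrable_def]
  show "(LINT x:{0..m}|lebesgue. col_int n f x) = (LINT z:rect m n|lebesgue. f z)"
    using lebesgue_integral_fst[OF f'] unfolding eq set_lebesgue_integral_def .
qed

text \<open>The weight is constant on each vertical section, so it leaves the inner integral in
  Fubini's theorem. Its boundedness keeps the product integrable.\<close>

lemma
  assumes f: "set_integrable lebesgue (rect m n) f"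
    and u: "u \<in> borel_measurable lebesgue" and K: "\<And>x. \<bar>u x\<bar> \<le> K"
  shows set_integrable_weight_fst: "set_integrable lebesgue (rect m n) (\<lambda>z. u (fst z) * f z)"
    and set_integral_weight_fst: "(LINT z:rect m n|lebesgue. u (fst z) * f z) =
      (LINT x:{0..m}|lebesgue. u x * col_int n f x)"
proof -
  have "(\<lambda>z. u (fst z)) \<in> borel_measurable lebesgue"
    using measurable_compose[OF measurable_fst_lebesgue u] .
  then have "set_borel_measurable lebesgue (rect m n) (\<lambda>z. u (fst z))"
    unfolding set_borel_measurable_def using rect_lmeasurable[of m n]
    by (intro borel_measurable_scaleR borel_measurable_indicator) auto
  then show *: "set_integrable lebesgue (rect m n) (\<lambda>z. u (fst z) * f z)"
    using f K by (intro set_integrable_mult_bounded)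
  show "(LINT z:rect m n|lebesgue. u (fst z) * f z) =
      (LINT x:{0..m}|lebesgue. u x * col_int n f x)"
    \<comment> \<open>Pulling the factor \<open>u x\<close> out of the inner integral is valid for
      every \<open>x\<close>: if the section of \<open>f\<close> is not integrable, both sides are 0
      by convention.\<close>
    using set_integral_col_int[OF *] by (simp add: col_int_def)
qed

lemma
  assumes f: "set_integrable lebesgue (rect m n) f"
    and u: "u \<in> borel_measurable lebesgue" and K: "\<And>y. \<bar>u y\<bar> \<le> K"
  shows set_integrable_weight_snd: "set_integrable lebesgue (rect m n) (\<lambda>z. u (snd z) * f z)"
    and set_integral_weight_snd: "(LINT z:rect m n|lebesgue. u (snd z) * f z) =
      (LINT y:{0..n}|lebesgue. u y * row_int m f y)"
proof -
  note f' = set_integrable_rect_swap[OF f]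
  show *: "set_integrable lebesgue (rect m n) (\<lambda>z. u (snd z) * f z)"
    using set_integrable_rect_swap[OF set_integrable_weight_fst[OF f' u K]] by simp
  show "(LINT z:rect m n|lebesgue. u (snd z) * f z) =
      (LINT y:{0..n}|lebesgue. u y * row_int m f y)"
    using set_integral_rect_swap[OF *] set_integral_weight_fst[OF f' u K] by (simp add: col_int_swap)
qed


section \<open>The projections of a bounded function and of the set \<open>A\<close>\<close>

lemma abs_col_int_le:
  assumes "n > 0" and K: "\<And>z. \<bar>f z\<bar> \<le> K"
  shows "\<bar>col_int n f x\<bar> \<le> K * n"
proof -
  have I: "integrable lebesgue (indicator {0..n} :: real \<Rightarrow> real)"
    by (intro integrable_indicator_lmeasurable) simp
  have K0: "K \<ge> 0" using K[of undefined] by linarith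
  show ?thesis
  proof (cases "set_integrable lebesgue {0..n} (\<lambda>y. f (x, y))")
    case True
    have "\<bar>col_int n f x\<bar> \<le> (LINT y:{0..n}|lebesgue. K)"
      unfolding col_int_def set_lebesgue_integral_def
    proof (rule integral_abs_bound_integral)
      show "integrable lebesgue (\<lambda>y. indicator {0..n} y *\<^sub>R f (x, y))"
        using True unfolding set_integrable_def .
      show "integrable lebesgue (\<lambda>y. indicator {0..n} y *\<^sub>R K)"
        using I by simp
    qed (use K K0 in \<open>auto simp: indicator_def\<close>)
    also have "\<dots> = K * n" using assms(1) by (simp add: set_lebesgue_integral_def)
    finally show ?thesis .
  next
    \<comment> \<open>A section that is not integrable has integral 0 by convention, so the bound
      holds at every \<open>x\<close> and not merely almost everywhere.\<close>
    case False
    then have "col_int n f x = 0"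
      unfolding col_int_def set_lebesgue_integral_def set_integrable_def
      by (rule not_integrable_integral_eq)
    then show ?thesis using assms(1) K0 by simp
  qed
qed

lemma abs_row_int_le:
  assumes "m > 0" and "\<And>z. \<bar>f z\<bar> \<le> K"
  shows "\<bar>row_int m f y\<bar> \<le> K * m"
  using abs_col_int_le[of m "\<lambda>z. f (prod.swap z)" K y] assms by (simp add: col_int_swap)

lemma integrable_indicator_rect:
  assumes "A \<in> sets lebesgue" and "A \<subseteq> rect m n"
  shows "integrable lebesgue (indicator A :: real \<times> real \<Rightarrow> real)"
proof -
  have "A \<in> lmeasurable"
    using fmeasurableI2[OF rect_lmeasurable assms(2,1)] .
  then show ?thesis by (rule integrable_indicator_lmeasurable)
qed

text \<open>Since \<open>A\<close> lies in the rectangle, integrating its indicator over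
  \<open>{0..n}\<close> is the same as integrating over the whole line, and Fubini applies
  directly.\<close>

lemma integrable_col_int_indicator:
  assumes "A \<in> sets lebesgue" and "A \<subseteq> rect m n"
  shows "integrable lebesgue (col_int n (indicator A))"
proof -
  have "col_int n (indicator A) = (\<lambda>x. LINT y|lebesgue. indicator A (x, y))"
    using assms(2) by (auto simp: fun_eq_iff col_int_def set_lebesgue_integral_def rect_def indicator_def
        intro!: Bochner_Integration.integral_cong)
  then show ?thesis using lebesgue_integrable_fst[OF integrable_indicator_rect[OF assms]] by simp
qed

lemma integrable_row_int_indicator:
  assumes "A \<in> sets lebesgue" and "A \<subseteq> rect m n"
  shows "integrable lebesgue (row_int m (indicator A))"
proof -
  have "row_int m (indicator A) = (\<lambda>y. LINT x|lebesgue. indicator A (prod.swap (y, x)))"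
    using assms(2) by (auto simp: fun_eq_iff row_int_def set_lebesgue_integral_def rect_def indicator_def
        intro!: Bochner_Integration.integral_cong)
  then show ?thesis
    using lebesgue_integrable_fst[OF lebesgue_integrable_swap[OF integrable_indicator_rect[OF assms]]]
    by simp
qed

lemma
  assumes "A \<in> sets lebesgue" and "A \<subseteq> rect m n"
  shows set_integral_col_int_indicator:
      "(LINT x:{0..m}|lebesgue. col_int n (indicator A) x) = measure lebesgue A"
    and set_integral_row_int_indicator:
      "(LINT y:{0..n}|lebesgue. row_int m (indicator A) y) = measure lebesgue A"
proof -
  have eq: "(\<lambda>z. indicator (rect m n) z *\<^sub>R (indicator A z :: real)) = indicator A"
    using assms(2) by (auto simp: indicator_def fun_eq_iff)
  have i: "set_integrable lebesgue (rect m n) (indicator A :: real \<times> real \<Rightarrow> real)"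
    unfolding set_integrable_def eq by (rule integrable_indicator_rect[OF assms])
  have T: "(LINT z:rect m n|lebesgue. indicator A z) = measure lebesgue A"
    unfolding set_lebesgue_integral_def eq using assms(1) by simp
  show "(LINT x:{0..m}|lebesgue. col_int n (indicator A) x) = measure lebesgue A"
    using set_integral_col_int[OF i] T by simp
  show "(LINT y:{0..n}|lebesgue. row_int m (indicator A) y) = measure lebesgue A"
    using set_integral_col_int[OF set_integrable_rect_swap[OF i]] set_integral_rect_swap[OF i] T
    by (simp add: col_int_swap)
qed

section \<open>The candidate \<open>min_sol\<close>: products with elements of
  \<open>same_proj\<close>, and its own membership\<close>

text \<open>The right-hand side of the integral formula does not mention \<open>f\<close>: pairing
  with \<open>min_sol m n A\<close> is constant on \<open>same_proj m n A\<close>. This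
  orthogonality relation is the core of the argument.\<close>

lemma
  assumes "m > 0" "n > 0" "A \<in> sets lebesgue" "A \<subseteq> rect m n"
    and f: "f \<in> same_proj m n A"
  shows set_integrable_min_sol_mult:
      "set_integrable lebesgue (rect m n) (\<lambda>z. min_sol m n A z * f z)"
    and set_integral_min_sol_mult:
      "(LINT z:rect m n|lebesgue. min_sol m n A z * f z) =
        (LINT x:{0..m}|lebesgue. (col_int n (indicator A) x / n) * col_int n (indicator A) x) +
        (LINT y:{0..n}|lebesgue. (row_int m (indicator A) y / m - measure lebesgue A / (m * n)) *
          row_int m (indicator A) y)"
proof -
  define u where "u x = col_int n (indicator A) x / n" for x
  define v where "v y = row_int m (indicator A) y / m - measure lebesgue A / (m * n)" for y
  have fi: "set_integrable lebesgue (rect m n) f" using f by (simp add: same_proj_def)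
  have um: "u \<in> borel_measurable lebesgue"
    using borel_measurable_integrable[OF integrable_col_int_indicator[OF assms(3,4)]]
    unfolding u_def[abs_def] by simp
  have vm: "v \<in> borel_measurable lebesgue"
    using borel_measurable_integrable[OF integrable_row_int_indicator[OF assms(3,4)]]
    unfolding v_def[abs_def] by simp
  have ub: "\<bar>u x\<bar> \<le> 1" for x
    using abs_col_int_le[of n "indicator A" 1 x] \<open>n > 0\<close> by (simp add: u_def indicator_def)
  have "\<bar>row_int m (indicator A) y / m\<bar> \<le> 1" for y
    using abs_row_int_le[of m "indicator A" 1 y] \<open>m > 0\<close> by (simp add: indicator_def)
  then have vb: "\<bar>v y\<bar> \<le> 1 + \<bar>measure lebesgue A / (m * n)\<bar>" for y
    unfolding v_def by (rule order_trans[OF abs_triangle_ineq4 add_right_mono])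
  \<comment> \<open>The constant term of \<open>min_sol\<close> is absorbed into \<open>v\<close>,
    leaving exactly one weight per coordinate.\<close>
  have eq: "min_sol m n A z * f z = u (fst z) * f z + v (snd z) * f z" for z
    by (cases z) (simp add: min_sol_def u_def v_def algebra_simps)
  note wu = set_integrable_weight_fst[OF fi um ub] set_integral_weight_fst[OF fi um ub]
  note wv = set_integrable_weight_snd[OF fi vm vb] set_integral_weight_snd[OF fi vm vb]
  show "set_integrable lebesgue (rect m n) (\<lambda>z. min_sol m n A z * f z)"
    unfolding eq using wu(1) wv(1) by (rule set_integral_add)
  have "(LINT z:rect m n|lebesgue. min_sol m n A z * f z) =
      (LINT x:{0..m}|lebesgue. u x * col_int n f x) + (LINT y:{0..n}|lebesgue. v y * row_int m f y)"
    unfolding eq set_integral_add(2)[OF wu(1) wv(1)] wu(2) wv(2) ..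
  \<comment> \<open>Here the projections of \<open>f\<close> are replaced by those of
    \<open>A\<close>, which removes \<open>f\<close> from the expression.\<close>
  also have "(LINT x:{0..m}|lebesgue. u x * col_int n f x) =
      (LINT x:{0..m}|lebesgue. u x * col_int n (indicator A) x)"
    using f by (intro set_lebesgue_integral_cong) (auto simp: same_proj_def)
  also have "(LINT y:{0..n}|lebesgue. v y * row_int m f y) =
      (LINT y:{0..n}|lebesgue. v y * row_int m (indicator A) y)"
    using f by (intro set_lebesgue_integral_cong) (auto simp: same_proj_def)
  finally show "(LINT z:rect m n|lebesgue. min_sol m n A z * f z) =
        (LINT x:{0..m}|lebesgue. (col_int n (indicator A) x / n) * col_int n (indicator A) x) +
        (LINT y:{0..n}|lebesgue. (row_int m (indicator A) y / m - measure lebesgue A / (m * n)) *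
          row_int m (indicator A) y)"
    by (simp add: u_def v_def)
qed

text \<open>Integrating \<open>min_sol\<close> over \<open>y\<close> reproduces the column
  projection from the first term, while the second term contributes \<open>l / m\<close> and the
  constant contributes \<open>- l / m\<close>. They cancel because the row projection has total
  integral \<open>l\<close>, the measure of \<open>A\<close>. Rows behave symmetrically.\<close>

lemma min_sol_in_same_proj:
  assumes "m > 0" "n > 0" "A \<in> sets lebesgue" "A \<subseteq> rect m n"
  shows "min_sol m n A \<in> same_proj m n A"
proof -
  define c where "c = col_int n (indicator A)"
  define r where "r = row_int m (indicator A)"
  define l where "l = measure lebesgue A"
  have f0: "min_sol m n A (x, y) = c x / n + r y / m - l / (m * n)" for x y
    by (simp add: min_sol_def c_def r_def l_def)
  have ci: "integrable lebesgue c" unfolding c_def by (rule integrable_col_int_indicator[OF assms(3,4)])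
  have ri: "integrable lebesgue r" unfolding r_def by (rule integrable_row_int_indicator[OF assms(3,4)])
  have cl: "(LINT x:{0..m}|lebesgue. c x) = l"
    unfolding c_def l_def by (rule set_integral_col_int_indicator[OF assms(3,4)])
  have rl: "(LINT y:{0..n}|lebesgue. r y) = l"
    unfolding r_def l_def by (rule set_integral_row_int_indicator[OF assms(3,4)])
  have cb: "\<bar>c x\<bar> \<le> n" for x
    using abs_col_int_le[of n "indicator A" 1 x] \<open>n > 0\<close> by (simp add: c_def indicator_def)
  have rb: "\<bar>r y\<bar> \<le> m" for y
    using abs_row_int_le[of m "indicator A" 1 y] \<open>m > 0\<close> by (simp add: r_def indicator_def)
  have one: "set_integrable lebesgue (rect m n) (\<lambda>z. 1 :: real)"
    using integrable_indicator_lmeasurable[OF rect_lmeasurable[of m n]] by (simp add: set_integrable_def)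
  \<comment> \<open>The factor 1 presents \<open>c\<close> and \<open>r\<close> as bounded weights
    on the constant function 1, which is integrable on the rectangle.\<close>
  have "set_integrable lebesgue (rect m n) (\<lambda>z. c (fst z) * 1)"
    "set_integrable lebesgue (rect m n) (\<lambda>z. r (snd z) * 1)"
    using set_integrable_weight_fst[OF one borel_measurable_integrable[OF ci] cb]
      set_integrable_weight_snd[OF one borel_measurable_integrable[OF ri] rb] .
  then have "set_integrable lebesgue (rect m n)
      (\<lambda>z. c (fst z) / n + r (snd z) / m - (l / (m * n)) * 1)"
    using one by (intro set_integral_add set_integral_diff set_integrable_mult_right) auto
  then have int: "set_integrable lebesgue (rect m n) (min_sol m n A)"
    by (rule set_integrable_cong[THEN iffD1, rotated -1]) (auto simp: f0)
  have "\<bar>min_sol m n A z\<bar> \<le> 1 + 1 + \<bar>l / (m * n)\<bar>" for z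
  proof (cases z)
    case (Pair x y)
    have "\<bar>c x / n\<bar> \<le> 1" "\<bar>r y / m\<bar> \<le> 1" using cb[of x] rb[of y] assms(1,2) by auto
    then show ?thesis unfolding Pair f0 by linarith
  qed
  then have bdd: "bounded (min_sol m n A ` rect m n)"
    unfolding bounded_iff real_norm_def by blast
  have cst: "set_integrable lebesgue {0..t} (\<lambda>z. k)" "(LINT x:{0..t}|lebesgue. k) = t * k"
    if "t > 0" for t k :: real
    using that by (simp_all add: set_integrable_def set_lebesgue_integral_def)
  have seti: "set_integrable lebesgue {0..t} f" if "integrable lebesgue f" for f :: "real \<Rightarrow> real" and t
    using that unfolding set_integrable_def by (intro integrable_mult_indicator) auto
  have col: "col_int n (min_sol m n A) x = c x" for x
  proof -
    have "col_int n (min_sol m n A) x =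
        (LINT y:{0..n}|lebesgue. (c x / n - l / (m * n)) + r y / m)"
      unfolding col_int_def f0 by (simp add: algebra_simps)
    also have "\<dots> = n * (c x / n - l / (m * n)) + l / m"
      using cst[OF \<open>n > 0\<close>] seti[OF ri, of n] rl
      by (subst set_integral_add(2)) auto
    finally show ?thesis using assms(1,2) by (simp add: field_simps)
  qed
  have row: "row_int m (min_sol m n A) y = r y" for y
  proof -
    have "row_int m (min_sol m n A) y =
        (LINT x:{0..m}|lebesgue. (r y / m - l / (m * n)) + c x / n)"
      unfolding row_int_def f0 by (simp add: algebra_simps)
    also have "\<dots> = m * (r y / m - l / (m * n)) + l / n"
      using cst[OF \<open>m > 0\<close>] seti[OF ci, of m] cl
      by (subst set_integral_add(2)) auto
    finally show ?thesis using assms(1,2) by (simp add: field_simps)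
  qed
  show ?thesis
    unfolding same_proj_def using bdd int col row by (auto simp: c_def r_def)
qed

section \<open>Pythagorean identity, minimality and uniqueness almost everywhere\<close>

theorem theorem7p1:
  fixes m n :: real and A :: "(real \<times> real) set"
  assumes "m > 0" and "n > 0"
    and "A \<in> sets lebesgue" and "A \<subseteq> rect m n"
  shows "min_sol m n A \<in> same_proj m n A
    \<and> (\<forall>f\<in>same_proj m n A. rect_norm m n (min_sol m n A) \<le> rect_norm m n f)
    \<and> (\<forall>f\<in>same_proj m n A. rect_norm m n f = rect_norm m n (min_sol m n A) \<longrightarrow>
         (AE z in lebesgue. z \<in> rect m n \<longrightarrow> f z = min_sol m n A z))"
proof (intro conjI ballI impI)
  define f0 where "f0 = min_sol m n A"
  show f0: "min_sol m n A \<in> same_proj m n A" by (rule min_sol_in_same_proj[OF assms])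
  \<comment> \<open>Square integrability comes from boundedness: one factor acts as a bounded weight
    on the other, integrable one.\<close>
  have sq: "set_integrable lebesgue (rect m n) (\<lambda>z. f z * f z)" if f: "f \<in> same_proj m n A" for f
  proof -
    obtain K where K: "\<And>z. z \<in> rect m n \<Longrightarrow> \<bar>f z\<bar> \<le> K"
      using f unfolding same_proj_def bounded_iff by auto
    have fi: "set_integrable lebesgue (rect m n) f" using f by (simp add: same_proj_def)
    then have "set_borel_measurable lebesgue (rect m n) f"
      unfolding set_integrable_def set_borel_measurable_def by simp
    then show ?thesis using fi K by (intro set_integrable_mult_bounded)
  qed
  have pyth: "set_integrable lebesgue (rect m n) (\<lambda>z. (f z - f0 z)\<^sup>2)"
      "(LINT z:rect m n|lebesgue. (f z - f0 z)\<^sup>2) =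
        (LINT z:rect m n|lebesgue. (f z)\<^sup>2) - (LINT z:rect m n|lebesgue. (f0 z)\<^sup>2)"
    if f: "f \<in> same_proj m n A" for f
  proof -
    have eq: "(f z - f0 z)\<^sup>2 = (f z * f z + f0 z * f0 z) - 2 * (f0 z * f z)" for z
      by (simp add: power2_eq_square algebra_simps)
    have ff: "set_integrable lebesgue (rect m n) (\<lambda>z. f z * f z)" using sq[OF f] .
    have gg: "set_integrable lebesgue (rect m n) (\<lambda>z. f0 z * f0 z)" using sq[OF f0] by (simp add: f0_def)
    have gf: "set_integrable lebesgue (rect m n) (\<lambda>z. 2 * (f0 z * f z))"
      using set_integrable_min_sol_mult[OF assms f] by (simp add: f0_def)
    show "set_integrable lebesgue (rect m n) (\<lambda>z. (f z - f0 z)\<^sup>2)"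
      unfolding eq by (intro set_integral_diff set_integral_add ff gg gf)
    \<comment> \<open>Both \<open>f\<close> and \<open>f0\<close> belong to
      \<open>same_proj m n A\<close>, so the pairing formula gives the same value for each. The
      cross term thus becomes minus twice the integral of the square of \<open>f0\<close>.\<close>
    have "(LINT z:rect m n|lebesgue. f0 z * f z) = (LINT z:rect m n|lebesgue. f0 z * f0 z)"
      unfolding f0_def set_integral_min_sol_mult[OF assms f] set_integral_min_sol_mult[OF assms f0] ..
    then show "(LINT z:rect m n|lebesgue. (f z - f0 z)\<^sup>2) =
        (LINT z:rect m n|lebesgue. (f z)\<^sup>2) - (LINT z:rect m n|lebesgue. (f0 z)\<^sup>2)"
      unfolding eq set_integral_diff(2)[OF set_integral_add(1)[OF ff gg] gf]
        set_integral_add(2)[OF ff gg] by (simp add: power2_eq_square)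
  qed
  show "rect_norm m n (min_sol m n A) \<le> rect_norm m n f" if f: "f \<in> same_proj m n A" for f
  proof -
    have "0 \<le> (LINT z:rect m n|lebesgue. (f z - f0 z)\<^sup>2)"
      unfolding set_lebesgue_integral_def by (intro integral_nonneg_AE) auto
    then show ?thesis unfolding rect_norm_def pyth(2)[OF f] by (simp add: f0_def)
  qed
  show "AE z in lebesgue. z \<in> rect m n \<longrightarrow> f z = min_sol m n A z"
    if f: "f \<in> same_proj m n A" and eq: "rect_norm m n f = rect_norm m n (min_sol m n A)" for f
  proof -
    have "(LINT z:rect m n|lebesgue. (f z - f0 z)\<^sup>2) = 0"
      using eq unfolding pyth(2)[OF f] by (simp add: rect_norm_def f0_def)
    moreover have "0 \<le> indicator (rect m n) z *\<^sub>R (f z - f0 z)\<^sup>2" for z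
      by simp
    \<comment> \<open>A nonnegative integrable function with integral 0 vanishes almost everywhere.
      The integrability half of \<open>pyth\<close> is essential, since a non-integrable function
      would also have integral 0 by convention.\<close>
    ultimately have "AE z in lebesgue. indicator (rect m n) z *\<^sub>R (f z - f0 z)\<^sup>2 = 0"
      using pyth(1)[OF f] unfolding set_lebesgue_integral_def set_integrable_def
      by (subst integral_nonneg_eq_0_iff_AE[symmetric]) auto
    then show ?thesis
      by eventually_elim (auto simp: f0_def)
  qed
qed

end
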